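(* For every nonnegative integer $n$, let $LG_1(n)$ be the number of partitions of $n$ in which any two consecutive parts differ by at least $2$, and by at least $4$ if both are odd. Let $E(n)$ be the number of signed partitions of $n$ with $k$ positive parts, which are even and distinct, and $t$ negative parts, which are odd, distinct and each less than $2k$, such that the smallest positive part is greater than $2t-\delta_{1u}$, where $u$ is the smallest negative part (and $\delta_{1u}=1$ if $u=1$, $\delta_{1u}=0$ otherwise, including when there are no negative parts). Then $LG_1(n)=E(n)$ for all $n\ge 0$.
   Context: A partition of an integer $n$ is a finite nonincreasing sequence of positive integers (its parts) summing to $n$. A signed partition of an integer $n$ is a pair $(\pi,\nu)$ of ordinary partitions with $|\pi|-|\nu|=n$, where $|\cdot|$ denotes the sum of parts; the parts of $\pi$ are the positive parts and the parts of $\nu$ are the negative parts (their sizes). $\delta$ is the Kronecker delta. *)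

theory Defs
  imports Main
begin

definition is_partition :: "nat list \<Rightarrow> bool" where
  "is_partition xs \<longleftrightarrow> sorted_wrt (\<ge>) xs \<and> (\<forall>x\<in>set xs. 0 < x)"

definition partition_of :: "nat list \<Rightarrow> nat \<Rightarrow> bool" where
  "partition_of xs n \<longleftrightarrow> is_partition xs \<and> sum_list xs = n"

definition signed_partition_of :: "nat list \<times> nat list \<Rightarrow> int \<Rightarrow> bool" where
  "signed_partition_of s n \<longleftrightarrow>
     is_partition (fst s) \<and> is_partition (snd s) \<and>
     int (sum_list (fst s)) - int (sum_list (snd s)) = n"

definition LG1_set :: "nat \<Rightarrow> nat list set" where
  "LG1_set n = {xs. partition_of xs n \<and>
     (\<forall>i. Suc i < length xs \<longrightarrow>
        int (xs ! i) - int (xs ! Suc i) \<ge> 2 \<and>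
        (odd (xs ! i) \<and> odd (xs ! Suc i) \<longrightarrow> int (xs ! i) - int (xs ! Suc i) \<ge> 4))}"

definition LG1 :: "nat \<Rightarrow> nat" where
  "LG1 n = card (LG1_set n)"

definition delta1 :: "nat list \<Rightarrow> int" where
  "delta1 ys = (if ys \<noteq> [] \<and> Min (set ys) = 1 then 1 else 0)"

text \<open>
  The condition on the smallest positive part is vacuous when there are no positive parts;
  in that case there are no negative parts either, since these are less than \<open>2 * 0\<close>.
  The bound is an integer expression, so the subtraction is not truncated.
\<close>

definition E_set :: "nat \<Rightarrow> (nat list \<times> nat list) set" where
  "E_set n = {(ps, ns). signed_partition_of (ps, ns) (int n) \<and>
     distinct ps \<and> (\<forall>p\<in>set ps. even p) \<and>
     distinct ns \<and> (\<forall>m\<in>set ns. odd m \<and> m < 2 * length ps) \<and>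
     (ps \<noteq> [] \<longrightarrow> int (Min (set ps)) > 2 * int (length ns) - delta1 ns)}"

definition E :: "nat \<Rightarrow> nat" where
  "E n = card (E_set n)"

end

theory Submission
  imports Defs
begin

text \<open>
  Let \<open>x\<^sub>k < \<dots> < x\<^sub>2 < x\<^sub>1\<close> be the parts of a partition counted by \<open>LG1\<close>. Rounding each odd part up
  to the next even number and then adding to it \<open>2\<close> for every larger odd part gives distinct even
  positive parts: the gap conditions say exactly that these are distinct and not too small. An odd
  part \<open>x\<^sub>i\<close> thus adds \<open>1 + 2 (k - i)\<close> to the total, which the negative part \<open>2 (k - i) + 1\<close>
  compensates. The negative parts record which of the \<open>x\<^sub>i\<close> were odd, so the map is a bijection.
\<close>

definition gap :: "nat \<Rightarrow> nat \<Rightarrow> bool" where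
  "gap x y \<longleftrightarrow> y + 2 \<le> x \<and> (odd x \<and> odd y \<longrightarrow> y + 4 \<le> x)"

definition gap_partition :: "nat list \<Rightarrow> bool" where
  "gap_partition xs \<longleftrightarrow> successively gap xs \<and> (\<forall>x\<in>set xs. 0 < x)"

text \<open>The accumulator \<open>c\<close> counts the odd parts already passed.\<close>

fun pos_parts :: "nat \<Rightarrow> nat list \<Rightarrow> nat list" where
  "pos_parts c [] = []"
| "pos_parts c (x # xs) =
     (x + of_bool (odd x) + 2 * c) # pos_parts (c + of_bool (odd x)) xs"

fun neg_parts :: "nat list \<Rightarrow> nat list" where
  "neg_parts [] = []"
| "neg_parts (x # xs) = (if odd x then [2 * length xs + 1] else []) @ neg_parts xs"

text \<open>For \<open>c = 0\<close> this is the condition behind \<open>E_set\<close>; a general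
  \<open>c\<close> describes the tail left after \<open>c\<close> odd parts, whose positive parts
  have all been raised by \<open>2 * c\<close>. Moving the delta term to the right-hand side avoids
  truncated subtraction.\<close>

definition admissible :: "nat \<Rightarrow> nat list \<Rightarrow> nat list \<Rightarrow> bool" where
  "admissible c ps ns \<longleftrightarrow>
     sorted_wrt (>) ps \<and> (\<forall>p\<in>set ps. even p) \<and>
     sorted_wrt (>) ns \<and> (\<forall>m\<in>set ns. odd m \<and> m < 2 * length ps) \<and>
     (\<forall>p\<in>set ps. 2 * (c + length ns) < p + of_bool (1 \<in> set ns))"

lemma length_pos_parts [simp]: "length (pos_parts c xs) = length xs"
  by (induction xs arbitrary: c) auto

lemma neg_parts_odd_less: "m \<in> set (neg_parts xs) \<Longrightarrow> odd m \<and> m < 2 * length xs"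
  by (induction xs) (auto split: if_splits)

text \<open>An odd part gains 1 from rounding and raises each later entry by 2, which together is
  its negative part; the initial \<open>c\<close> raises every entry by
  \<open>2 * c\<close>.\<close>

lemma sum_pos_parts:
  "sum_list (pos_parts c xs) = sum_list xs + sum_list (neg_parts xs) + 2 * c * length xs"
  by (induction xs arbitrary: c) (auto simp: algebra_simps)

lemma sorted_wrt_greater_le_hd:
  "sorted_wrt (>) (h # qs) \<Longrightarrow> q \<in> set (h # qs) \<Longrightarrow> q \<le> h" for h :: nat
  by auto

lemma admissible_parts:
  assumes "gap_partition xs"
  shows "admissible c (pos_parts c xs) (neg_parts xs)"
  using assms
proof (induction xs arbitrary: c)
  case Nil
  then show ?case by (simp add: admissible_def)
next
  case (Cons x xs)
  show ?case
  \<comment> \<open>A single part is treated apart because only the last part can yield the negative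
    part 1.\<close>
  proof (cases xs)
    case Nil
    with Cons.prems show ?thesis by (auto simp: admissible_def gap_partition_def)
  next
    case (Cons y ys)
    let ?c = "c + of_bool (odd x)"
    have g: "gap x y" and "gap_partition xs"
      using Cons.prems \<open>xs = y # ys\<close> by (auto simp: gap_partition_def)
    then have IH: "admissible ?c (pos_parts ?c xs) (neg_parts xs)"
      using Cons.IH by blast
    let ?p = "x + of_bool (odd x) + 2 * c"
    \<comment> \<open>The four parity cases of \<open>gap\<close> are what is needed here: in the
      odd-odd case the successor gains 2 more than \<open>x\<close> does, hence the gap of
      4.\<close>
    have first: "y + of_bool (odd y) + 2 * ?c < ?p"
      using g by (cases "odd x"; cases "odd y"; simp add: gap_def; presburger)
    have less: "\<forall>q\<in>set (pos_parts ?c xs). q < ?p"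
    proof
      fix q assume "q \<in> set (pos_parts ?c xs)"
      then have "q \<le> y + of_bool (odd y) + 2 * ?c"
        using IH unfolding admissible_def \<open>xs = y # ys\<close> pos_parts.simps
        by (blast intro: sorted_wrt_greater_le_hd)
      with first show "q < ?p" by linarith
    qed
    have y_mem: "y + of_bool (odd y) + 2 * ?c \<in> set (pos_parts ?c xs)"
      using \<open>xs = y # ys\<close> by simp
    have one: "1 \<in> set (neg_parts (x # xs)) \<longleftrightarrow> 1 \<in> set (neg_parts xs)"
      using \<open>xs = y # ys\<close> by auto
    \<comment> \<open>An odd \<open>x\<close> moves one unit from the count of negative parts to the
      accumulator, so the lower bound is the same for the tail and the whole list.\<close>
    have len: "c + length (neg_parts (x # xs)) = ?c + length (neg_parts xs)"
      by simp
    have "2 * (?c + length (neg_parts xs)) < q + of_bool (1 \<in> set (neg_parts xs))"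
      if "q \<in> set (pos_parts ?c xs)" for q
      using IH that unfolding admissible_def by blast
    moreover from this[OF y_mem]
    have "2 * (?c + length (neg_parts xs)) < ?p + of_bool (1 \<in> set (neg_parts xs))"
      using first by linarith
    ultimately have "\<forall>p\<in>set (pos_parts c (x # xs)).
        2 * (c + length (neg_parts (x # xs))) < p + of_bool (1 \<in> set (neg_parts (x # xs)))"
      unfolding one len pos_parts.simps list.set by blast
    moreover have "sorted_wrt (>) (pos_parts c (x # xs))"
      using IH less unfolding admissible_def pos_parts.simps sorted_wrt.simps by blast
    moreover have "\<forall>p\<in>set (pos_parts c (x # xs)). even p"
    proof -
      have "even ?p" by simp
      then show ?thesis using IH unfolding admissible_def pos_parts.simps list.set by blast
    qed
    moreover have "sorted_wrt (>) (neg_parts (x # xs))"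
    proof -
      have "sorted_wrt (>) (neg_parts xs)" using IH unfolding admissible_def by blast
      then show ?thesis by (auto dest: neg_parts_odd_less)
    qed
    moreover have "\<forall>m\<in>set (neg_parts (x # xs)).
        odd m \<and> m < 2 * length (pos_parts c (x # xs))"
      using neg_parts_odd_less unfolding length_pos_parts by blast
    ultimately show ?thesis
      unfolding admissible_def by blast
  qed
qed

text \<open>The positive parts fix the length, and the negative parts then tell the parity of the
  head, since the tail only produces smaller ones. Head and next accumulator are thus
  determined.\<close>

lemma parts_inj:
  assumes "pos_parts c xs = pos_parts c ys" "neg_parts xs = neg_parts ys"
  shows "xs = ys"
  using assms
proof (induction xs arbitrary: c ys)
  case Nil
  then show ?case by (cases ys) auto
next
  case (Cons x xs)
  then obtain y ys' where ys: "ys = y # ys'" by (cases ys) auto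
  have len: "length xs = length ys'"
    using arg_cong[OF Cons.prems(1), of length] ys by simp
  have mem: "odd z \<longleftrightarrow> 2 * length zs + 1 \<in> set (neg_parts (z # zs))" for z zs
    using neg_parts_odd_less[of "2 * length zs + 1" zs] by auto
  have "odd x \<longleftrightarrow> odd y"
    using mem[of x xs] mem[of y ys'] Cons.prems(2) ys len by metis
  then show ?case
    using Cons.prems Cons.IH[of _ ys'] ys len by (auto split: if_splits)
qed

lemma parts_surj:
  assumes "admissible c ps ns"
  shows "\<exists>xs. gap_partition xs \<and> pos_parts c xs = ps \<and> neg_parts xs = ns"
  using assms
proof (induction ps arbitrary: c ns)
  case Nil
  then have "ns = []" by (cases ns) (auto simp: admissible_def)
  then show ?case by (intro exI[of _ "[]"]) (simp add: gap_partition_def)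
next
  case (Cons p ps)
  \<comment> \<open>\<open>b\<close> is the parity of the part to be recovered from
    \<open>p\<close>. The value tested is the largest one allowed, so if present it heads
    \<open>ns\<close>.\<close>
  define b :: bool where "b \<longleftrightarrow> 2 * length ps + 1 \<in> set ns"
  obtain ns' where ns: "ns = (if b then [2 * length ps + 1] else []) @ ns'"
    and ns'_less: "\<forall>m\<in>set ns'. m < 2 * length ps"
  proof (cases b)
    case True
    then obtain m ms where m: "ns = m # ms" unfolding b_def by (cases ns) auto
    have "m < 2 * length ps + 2"
      using Cons.prems m by (simp add: admissible_def)
    moreover have "2 * length ps + 1 \<le> m"
      using Cons.prems True m unfolding admissible_def b_def
      by (blast intro: sorted_wrt_greater_le_hd)
    ultimately have m_eq: "m = 2 * length ps + 1" by linarith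
    have "\<forall>i\<in>set ms. i < 2 * length ps"
    proof
      fix i assume "i \<in> set ms"
      then have "odd i" "i < 2 * length ps + 1"
        using Cons.prems m m_eq by (auto simp: admissible_def)
      then show "i < 2 * length ps" by presburger
    qed
    then show ?thesis using that True m m_eq by auto
  next
    case False
    have "\<forall>i\<in>set ns. i < 2 * length ps"
    proof
      fix i assume i: "i \<in> set ns"
      then have "odd i" "i < 2 * length ps + 2" "i \<noteq> 2 * length ps + 1"
        using Cons.prems False by (auto simp: admissible_def b_def)
      then show "i < 2 * length ps" by presburger
    qed
    then show ?thesis using that[of ns] False by auto
  qed
  let ?c = "c + of_bool b"
  \<comment> \<open>For empty \<open>ps\<close> the removed negative part is 1 itself.\<close>
  have one: "1 \<in> set ns \<longleftrightarrow> 1 \<in> set ns'" if "ps \<noteq> []"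
    using that ns by auto
  have len: "c + length ns = ?c + length ns'"
    using ns by simp
  have "admissible ?c ps ns'"
    using Cons.prems ns ns'_less one len unfolding admissible_def
    by (cases "ps = []") (auto simp: sorted_wrt_append split: if_splits)
  then obtain xs where xs: "gap_partition xs" "pos_parts ?c xs = ps" "neg_parts xs = ns'"
    using Cons.IH by blast
  have lenxs: "length xs = length ps" using xs(2) by auto
  have "even p" and p_gt: "2 * (?c + length ns') < p + of_bool (1 \<in> set ns)"
    using Cons.prems len by (auto simp: admissible_def)
  have one_le: "of_bool (1 \<in> set ns) \<le> of_bool b + length ns'"
    using ns by (cases ns') auto
  \<comment> \<open>This makes the subtraction defining \<open>x\<close> exact and \<open>x\<close>
    positive. If 1 is a negative part, the bound is weaker by one, but then \<open>one_le\<close>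
    supplies at least one negative part to compensate.\<close>
  have p_ge: "2 * c + of_bool b < p"
    using p_gt one_le \<open>even p\<close>
    by (cases b; cases "1 \<in> set ns"; simp; presburger)
  define x where "x = p - 2 * c - of_bool b"
  have p: "p = x + of_bool b + 2 * c" and "0 < x" using p_ge by (auto simp: x_def)
  have odd_x: "odd x \<longleftrightarrow> b" using p \<open>even p\<close> by (cases b) auto
  \<comment> \<open>Conversely, strict descent of the even positive parts gives the gaps: parity
    lifts a difference above 2 to 4 for two odd parts.\<close>
  have "gap x y" if "xs = y # ys" for y ys
  proof -
    have "y + of_bool (odd y) + 2 * ?c \<in> set ps" using xs(2) that by auto
    then have "y + of_bool (odd y) + 2 * ?c < x + of_bool (odd x) + 2 * c"
      using Cons.prems p odd_x by (auto simp: admissible_def)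
    then show ?thesis
      unfolding gap_def odd_x[symmetric]
      by (cases "odd x"; cases "odd y"; simp; presburger)
  qed
  then have "gap_partition (x # xs)"
    using xs(1) \<open>0 < x\<close> by (cases xs) (auto simp: gap_partition_def)
  moreover have "pos_parts c (x # xs) = p # ps" "neg_parts (x # xs) = ns"
    using xs p odd_x ns lenxs by auto
  ultimately show ?case by blast
qed

lemma LG1_set_eq: "LG1_set n = {xs. gap_partition xs \<and> sum_list xs = n}"
proof -
  have succ: "(\<forall>i. Suc i < length xs \<longrightarrow>
        int (xs ! i) - int (xs ! Suc i) \<ge> 2 \<and>
        (odd (xs ! i) \<and> odd (xs ! Suc i) \<longrightarrow> int (xs ! i) - int (xs ! Suc i) \<ge> 4))
      \<longleftrightarrow> successively gap xs" for xs
    unfolding successively_conv_nth gap_def by (intro all_cong1) auto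
  have "sorted_wrt (\<ge>) xs" if "successively gap xs" for xs
  proof -
    have "successively (\<ge>) xs"
      by (rule successively_mono[OF that]) (simp add: gap_def)
    then show ?thesis
      by (simp add: successively_conv_sorted_wrt transp_on_ge)
  qed
  then show ?thesis
    unfolding LG1_set_def succ partition_of_def is_partition_def gap_partition_def by auto
qed

lemma sorted_wrt_greater_iff:
  "sorted_wrt (>) xs \<longleftrightarrow> sorted_wrt (\<ge>) xs \<and> distinct xs" for xs :: "nat list"
  by (induction xs) (auto simp: order_le_less)

lemma E_set_eq:
  "E_set n = {(ps, ns). admissible 0 ps ns \<and> sum_list ps = n + sum_list ns}"
proof -
  \<comment> \<open>Oddness excludes 0 from \<open>ns\<close>, so the minimum is 1 exactly when 1
    occurs.\<close>
  have bound: "(ps \<noteq> [] \<longrightarrow> int (Min (set ps)) > 2 * int (length ns) - delta1 ns) \<longleftrightarrow>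
      (\<forall>p\<in>set ps. 2 * length ns < p + of_bool (1 \<in> set ns))"
    if "\<forall>m\<in>set ns. odd m" for ps ns :: "nat list"
  proof -
    have "Min (set ns) = 1 \<longleftrightarrow> 1 \<in> set ns" if "ns \<noteq> []"
    proof
      assume "Min (set ns) = 1"
      then show "1 \<in> set ns" using Min_in[of "set ns"] that by simp
    next
      assume "1 \<in> set ns"
      moreover have "\<forall>m\<in>set ns. 1 \<le> m"
        using \<open>\<forall>m\<in>set ns. odd m\<close> by (metis odd_pos less_eq_Suc_le One_nat_def)
      ultimately show "Min (set ns) = 1" by (intro Min_eqI) auto
    qed
    then have d: "delta1 ns = of_bool (1 \<in> set ns)"
      by (cases "ns = []") (auto simp: delta1_def)
    show ?thesis
    proof (cases "ps = []")
      case False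
      have "int (Min (set ps)) > 2 * int (length ns) - delta1 ns \<longleftrightarrow>
          2 * length ns < Min (set ps) + of_bool (1 \<in> set ns)"
        unfolding d by (cases "1 \<in> set ns") (simp_all, linarith+)
      also have "\<dots> \<longleftrightarrow> 2 * length ns + 1 - of_bool (1 \<in> set ns) \<le> Min (set ps)"
        by (cases "1 \<in> set ns") auto
      also have "\<dots> \<longleftrightarrow> (\<forall>p\<in>set ps. 2 * length ns + 1 - of_bool (1 \<in> set ns) \<le> p)"
        using False by simp
      also have "\<dots> \<longleftrightarrow> (\<forall>p\<in>set ps. 2 * length ns < p + of_bool (1 \<in> set ns))"
        by (cases "1 \<in> set ns") auto
      finally show ?thesis using False by blast
    qed auto
  qed
  \<comment> \<open>\<open>E_set\<close> also demands positive parts; the lower bound implies this,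
    since 1 in \<open>ns\<close> forces \<open>length ns\<close> to be at least 1.\<close>
  have positive: "0 < p"
    if "2 * length ns < p + of_bool (1 \<in> set ns)" for p and ns :: "nat list"
    using that by (cases ns; cases "1 \<in> set ns") auto
  have "(ps, ns) \<in> E_set n \<longleftrightarrow> admissible 0 ps ns \<and> sum_list ps = n + sum_list ns" for ps ns
  proof (cases "\<forall>m\<in>set ns. odd m")
    case True
    then have "\<forall>m\<in>set ns. 0 < m" by (auto intro: odd_pos)
    moreover have "int (sum_list ps) - int (sum_list ns) = int n \<longleftrightarrow> sum_list ps = n + sum_list ns"
      by linarith
    ultimately show ?thesis
      unfolding E_set_def signed_partition_of_def is_partition_def admissible_def
        sorted_wrt_greater_iff mem_Collect_eq prod.case fst_conv snd_conv bound[OF True] add_0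
      using positive[of ns] by blast
  next
    case False
    then show ?thesis unfolding E_set_def admissible_def by blast
  qed
  then show ?thesis by auto
qed

theorem theorem5p1:
  shows "\<forall>n::nat. LG1 n = E n"
proof
  fix n
  let ?f = "\<lambda>xs. (pos_parts 0 xs, neg_parts xs)"
  have "bij_betw ?f (LG1_set n) (E_set n)"
    unfolding bij_betw_def
  proof
    show "inj_on ?f (LG1_set n)"
      by (rule inj_onI) (auto intro: parts_inj)
    show "?f ` LG1_set n = E_set n"
    proof (intro equalityI subsetI)
      fix s assume "s \<in> ?f ` LG1_set n"
      then show "s \<in> E_set n"
        by (auto simp: LG1_set_eq E_set_eq admissible_parts sum_pos_parts)
    next
      fix s assume "s \<in> E_set n"
      then obtain ps ns where s: "s = (ps, ns)" "admissible 0 ps ns"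
          "sum_list ps = n + sum_list ns"
        by (auto simp: E_set_eq)
      then obtain xs where "gap_partition xs" "pos_parts 0 xs = ps" "neg_parts xs = ns"
        using parts_surj by blast
      \<comment> \<open>At \<open>c = 0\<close> the positive sum exceeds the negative sum by exactly
        the sum of \<open>xs\<close>, which is therefore \<open>n\<close>.\<close>
      with s show "s \<in> ?f ` LG1_set n"
        using sum_pos_parts[of 0 xs] by (auto simp: LG1_set_eq image_iff)
    qed
  qed
  then show "LG1 n = E n"
    unfolding LG1_def E_def by (rule bij_betw_same_card)
qed

end
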